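(* Let $K\subseteq\mathbb{R}^d$ and let $C\subset\mathbb{R}^d$ be a compact convex set with $0\in\operatorname{int}(C)$. Then $$R_\pi^1(K,C)\leq R_\pi^2(K,C)\leq\cdots\leq R_\pi^d(K,C)$$ and $$R^\pi_1(K,C)\leq R^\pi_2(K,C)\leq\cdots\leq R^\pi_d(K,C).$$
   Context: For $0\le i\le d$, $\mathcal{L}^d_i$ denotes the family of all $i$-dimensional linear subspaces of $\mathbb{R}^d$. Sums of sets are Minkowski sums. All infima and suprema are taken in $\mathbb{R}\cup\{\pm\infty\}$, with $\inf\emptyset=+\infty$. For $j\in\{1,\ldots,d\}$ define $$R_\pi^j(K,C)=\sup_{L\in\mathcal{L}^d_{d-j}}\ \inf_{x\in\mathbb{R}^d}\ \inf\{\lambda\geq 0 : K\subseteq x+L+\lambda C\},$$ $$R^\pi_j(K,C)=\inf_{L\in\mathcal{L}^d_{d-j}}\ \inf_{x\in\mathbb{R}^d}\ \inf\{\lambda\geq 0 : K\subseteq x+L+\lambda C\}.$$ *)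

theory Defs
  imports "HOL-Analysis.Analysis" "HOL-Library.Set_Algebras"
begin

definition linear_subspaces :: "nat \<Rightarrow> (real ^ 'n) set set" where
  "linear_subspaces i = {L. subspace L \<and> dim L = i}"

text \<open>
  The inner \<open>+\<close> is the Minkowski sum of \<open>HOL-Library.Set_Algebras\<close>. The radii take values in
  \<^typ>\<open>ereal\<close>, where the infimum of the empty set is \<open>\<infinity>\<close>. The subtraction \<open>CARD('n) - j\<close> is on
  \<^typ>\<open>nat\<close>, so the radii are meaningful only for \<open>1 \<le> j \<le> CARD('n)\<close>.
\<close>

definition sup_proj_radius :: "nat \<Rightarrow> (real ^ 'n) set \<Rightarrow> (real ^ 'n) set \<Rightarrow> ereal" where
  "sup_proj_radius j K C =
     (SUP L \<in> linear_subspaces (CARD('n) - j). INF x. INF r \<in> {r. 0 \<le> r \<and> K \<subseteq> {x} + L + (\<lambda>v. r *\<^sub>R v) ` C}. ereal r)"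

definition inf_proj_radius :: "nat \<Rightarrow> (real ^ 'n) set \<Rightarrow> (real ^ 'n) set \<Rightarrow> ereal" where
  "inf_proj_radius j K C =
     (INF L \<in> linear_subspaces (CARD('n) - j). INF x. INF r \<in> {r. 0 \<le> r \<and> K \<subseteq> {x} + L + (\<lambda>v. r *\<^sub>R v) ` C}. ereal r)"

end

theory Submission imports Defs begin

text \<open>For fixed \<open>K\<close> and \<open>C\<close>, enlarging \<open>L\<close> enlarges
  every cylinder \<open>{x} + L + r C\<close>, so the best radius can only drop
  (\<open>cylinder_radius_antimono\<close>). Passing from \<open>j\<close> to \<open>j + 1\<close>
  lowers the dimension of \<open>L\<close> by one. For the supremum, shrink each \<open>L\<close> to
  a hyperplane of it (\<open>linear_subspaces_subspace\<close>); for the infimum, extend each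
  smaller space by one dimension (\<open>linear_subspaces_superspace\<close>).\<close>

definition cylinder_radius :: "(real ^ 'n) set \<Rightarrow> (real ^ 'n) set \<Rightarrow> (real ^ 'n) set \<Rightarrow> ereal" where
  "cylinder_radius K C L = (INF x. INF r \<in> {r. 0 \<le> r \<and> K \<subseteq> {x} + L + (\<lambda>v. r *\<^sub>R v) ` C}. ereal r)"

lemma cylinder_radius_antimono:
  assumes "M \<subseteq> L"
  shows "cylinder_radius K C L \<le> cylinder_radius K C M"
proof -
  have "{x} + M + (\<lambda>v. r *\<^sub>R v) ` C \<subseteq> {x} + L + (\<lambda>v. r *\<^sub>R v) ` C" for x r
    by (intro set_plus_mono2 order_refl assms)
  then show ?thesis
    unfolding cylinder_radius_def by (intro INF_mono' INF_superset_mono order_refl) blast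
qed

lemma linear_subspaces_subspace:
  assumes "L \<in> linear_subspaces (Suc k)"
  obtains M where "M \<in> linear_subspaces k" "M \<subseteq> L"
proof -
  from assms have L: "subspace L" "dim L = Suc k"
    by (auto simp: linear_subspaces_def)
  obtain M where "subspace M" "M \<subseteq> span L" "dim M = k"
    using choose_subspace_of_subspace[of k L] L(2) by auto
  moreover have "span L = L"
    using L(1) by (simp add: span_eq_iff)
  ultimately show thesis
    by (intro that[of M]) (auto simp: linear_subspaces_def)
qed

text \<open>The bound on \<open>k\<close> makes \<open>M\<close> a proper subspace, so some vector
  lies outside it; adjoining that vector raises the dimension by exactly one.\<close>

lemma linear_subspaces_superspace:
  fixes M :: "(real ^ 'n) set"
  assumes "M \<in> linear_subspaces k" "k < CARD('n)"
  obtains L where "L \<in> linear_subspaces (Suc k)" "M \<subseteq> L"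
proof -
  from assms have M: "subspace M" "dim M = k" "dim M < DIM(real ^ 'n)"
    by (auto simp: linear_subspaces_def)
  then obtain v where "v \<notin> span M"
    by (metis dim_UNIV dim_span UNIV_eq_I less_irrefl)
  then have "span (insert v M) \<in> linear_subspaces (Suc k)"
    using M by (simp add: linear_subspaces_def dim_insert)
  moreover have "M \<subseteq> span (insert v M)"
    by (meson span_superset subset_insertI subset_trans)
  ultimately show thesis by (rule that)
qed

theorem theorem3p4:
  fixes K C :: "(real ^ 'n) set"
  assumes "compact C" and "convex C" and "0 \<in> interior C"
  shows "(\<forall>j\<in>{1..<CARD('n)}. sup_proj_radius j K C \<le> sup_proj_radius (j + 1) K C) \<and>
         (\<forall>j\<in>{1..<CARD('n)}. inf_proj_radius j K C \<le> inf_proj_radius (j + 1) K C)"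
proof (intro conjI ballI)
  fix j assume "j \<in> {1..<CARD('n)}"
  \<comment> \<open>Since \<open>j < CARD('n)\<close>, the subtraction on naturals does not truncate
    and the two dimensions really differ by one.\<close>
  then have codim: "CARD('n) - j = Suc (CARD('n) - (j + 1))" "CARD('n) - (j + 1) < CARD('n)"
    by auto
  show "sup_proj_radius j K C \<le> sup_proj_radius (j + 1) K C"
    unfolding sup_proj_radius_def cylinder_radius_def[symmetric]
    by (rule SUP_mono)
      (metis codim(1) linear_subspaces_subspace cylinder_radius_antimono)
  show "inf_proj_radius j K C \<le> inf_proj_radius (j + 1) K C"
    unfolding inf_proj_radius_def cylinder_radius_def[symmetric]
    \<comment> \<open>The direction is opposite to \<open>SUP_mono\<close>: the given space is now
      the smaller one, and a larger one is sought.\<close>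
    by (rule INF_mono)
      (metis codim linear_subspaces_superspace cylinder_radius_antimono)
qed

end
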